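(* Let $\mathbb F$ be a field and let $\Delta,\delta_r,\delta_l:H\to H\amalg H$ be the co-operations of the Faà di Bruno coloop bialgebra $H=\mathbb F\langle x_n,\ n\ge1\rangle$ (defined in the context). They can be equivalently defined in terms of the operation $\rhd$ and the recursive operators $L_\ell$, $R_\ell$, $R^{\mathbf e}_\ell$: for every $n\ge1$, $$\Delta(x_n)=x_n+y_n+\sum_{\ell=1}^{n-1}\sum_{\mathbf n\in\mathcal C_n^{\ell+1}}x_{n_1}\rhd\big(y_{n_2}\otimes\cdots\otimes y_{n_{\ell+1}}\big),$$ $$\delta_r(x_n)=u_n+\sum_{\ell=1}^{n-1}(-1)^\ell\sum_{\mathbf n\in\mathcal C_n^{\ell+1}}L_\ell(u_{n_1},y_{n_2},\dots,y_{n_\ell})\rhd y_{n_{\ell+1}}=u_n+\sum_{\ell=1}^{n-1}(-1)^\ell\sum_{\mathbf n\in\mathcal C_n^{\ell+1}}u_{n_1}\rhd R_\ell(y_{n_2},\dots,y_{n_{\ell+1}}),$$ $$\delta_l(x_n)=v_n+\sum_{\ell=1}^{n-1}(-1)^\ell\sum_{\mathbf n\in\mathcal C_n^{\ell+1}}\sum_{\mathbf e\in\mathcal E_\ell}(-1)^{\mathbf e}\,x^{(e_1)}_{n_1}\rhd R_\ell^{\mathbf e}\big(x^{(e_2)}_{n_2},\dots,x^{(e_\ell)}_{n_\ell},v_{n_{\ell+1}}\big),$$ where $u_n=x_n-y_n$ and $v_n=y_n-x_n$.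
   Context: **Combinatorial data.** $\mathcal C_n^{\ell}$ is the set of compositions $\mathbf n=(n_1,\dots,n_\ell)$ of $n$ into $\ell$ positive integers. For $\ell\ge1$, $\mathcal M_\ell$ is the set of sequences $(m_1,\dots,m_\ell)$ of non-negative integers with $m_1+\cdots+m_\ell=\ell$ and $m_1+\cdots+m_j\ge j$ for $1\le j\le\ell-1$; $d_\ell(n_1,\dots,n_\ell)=\sum_{\mathbf m\in\mathcal M_\ell}\binom{n_1+1}{m_1}\cdots\binom{n_\ell+1}{m_\ell}$, $d_0=1$. $\mathcal E_\ell=\{1,2\}^\ell$; for $\mathbf e\in\mathcal E_\ell$, $\mathcal M_\ell^{\mathbf e}=\{\mathbf m\in\mathcal M_\ell\mid m_i=0\text{ whenever }e_i=2,\ 1\le i\le\ell\}$, $d_\ell^{\mathbf e}(n_1,\dots,n_\ell)=\sum_{\mathbf m\in\mathcal M_\ell^{\mathbf e}}\binom{n_1+1}{m_1}\cdots\binom{n_\ell+1}{m_\ell}$, $(-1)^{\mathbf e}=(-1)^{e_1+\cdots+e_\ell-\ell}$. **Co-operations.** $H\amalg H=\mathbb F\langle x_n,y_n,\ n\ge1\rangle$ is the free product of two copies of $H$, where $x_n=x_n^{(1)}$ and $y_n=x_n^{(2)}$ are the generators $x_n$ of the first and second copy. The co-operations are the algebra homomorphisms with $\Delta(x_n)=x_n+y_n+\sum_{\ell=1}^{n-1}\sum_{\mathbf n\in\mathcal C_n^{\ell+1}}\binom{n_1+1}{\ell}x_{n_1}y_{n_2}\cdots y_{n_{\ell+1}}$;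 $\delta_r(x_n)=\sum_{\ell=0}^{n-1}(-1)^\ell\sum_{\mathbf n\in\mathcal C_n^{\ell+1}}d_\ell(n_1,\dots,n_\ell)(x_{n_1}-y_{n_1})y_{n_2}\cdots y_{n_{\ell+1}}$; $\delta_l(x_n)=(y_n-x_n)+\sum_{\ell=1}^{n-1}(-1)^\ell\sum_{\mathbf n\in\mathcal C_n^{\ell+1}}\sum_{\mathbf e\in\mathcal E_\ell}(-1)^{\mathbf e}d_\ell^{\mathbf e}(n_1,\dots,n_\ell)\,x^{(e_1)}_{n_1}\cdots x^{(e_\ell)}_{n_\ell}(y_{n_{\ell+1}}-x_{n_{\ell+1}})$. **Operators.** Let $A=\bigoplus_{n\ge1}A_n$ be a positively graded (non-unital) associative $\mathbb F$-algebra, $|a|$ the degree of a homogeneous $a$, and $T(A)=\bigoplus_{\ell\ge0}A^{\otimes\ell}$. (In the theorem, $A$ is the non-unital algebra of polynomials without constant term in $\mathbb F\langle x_n,y_n\rangle$, with $|x_n|=|y_n|=n$.) The bilinear operation $\rhd:T(A)\otimes T(A)\to\mathbb F\oplus A$ is given on homogeneous elements by $(a_1\otimes\cdots\otimes a_{\ell'})\rhd(b_1\otimes\cdots\otimes b_{\ell''})=\binom{|a_1|+1}{\ell'+\ell''-1}a_1\cdots a_{\ell'}b_1\cdots b_{\ell''}$ for $\ell'\ge1,\ell''\ge0$ (for $\ell''=0$ the right argument is $1$), and $1\rhd1=1$, $1\rhd b=b$, $1\rhd(b_1\otimes\cdots\otimes b_\ell)=0$ for $\ell>1$. All operators below are linear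 on $A^{\otimes\ell}$, writing $X_\ell(a_1,\dots,a_\ell)=X_\ell(a_1\otimes\cdots\otimes a_\ell)$; those with index $0$ are the identity of $\mathbb F=A^{\otimes 0}$ (evaluated at $1$). $L_\ell(a_1,\dots,a_\ell)=\sum_{i=0}^{\ell-1}(-1)^{\ell-1-i}\big(L_i(a_1,\dots,a_i)\rhd a_{i+1}\big)\otimes a_{i+2}\otimes\cdots\otimes a_\ell$ for $\ell\ge1$. With $P_i=p_1+\cdots+p_i$, $P_0=0$: for $\ell\ge 1$, $R_\ell(a_1,\dots,a_\ell)=\sum_{j=1}^\ell\sum_{\mathbf p\in\mathcal C_\ell^j}\bigotimes_{i=1}^j\big(a_{P_{i-1}+1}\rhd R_{p_i-1}(a_{P_{i-1}+2},\dots,a_{P_i})\big)$ (tensor factors in increasing order of $i$). For $\mathbf e\in\mathcal E_\ell$: $R_1^{(1)}(a)=a$, $R_1^{(2)}(a)=0$, and for $\ell\ge2$, $R_\ell^{\mathbf e}(a_1,\dots,a_\ell)=\sum_{j=1}^\ell\sum_{\mathbf p\in\mathcal C_\ell^j}\big(R_1^{(e_1)}(a_1)\rhd R_{p_1-1}^{(e_2,\dots,e_{p_1})}(a_2,\dots,a_{p_1})\big)\otimes\bigotimes_{i=2}^j\big(a_{P_{i-1}+1}\rhd R_{p_i-1}^{(e_{P_{i-1}+2},\dots,e_{P_i})}(a_{P_{i-1}+2},\dots,a_{P_i})\big)$. *)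

theory Defs
  imports "HOL-Library.Poly_Mapping"
begin

section \<open>Free associative algebras\<close>

text \<open>
  Lists under concatenation are the free monoid, so that the convolution product of
  \<^theory>\<open>HOL-Library.Poly_Mapping\<close> makes \<open>'g list \<Rightarrow>\<^sub>0 'f\<close> the free associative unital algebra on
  \<open>'g\<close> over \<open>'f\<close>: noncommutative polynomials, with basis the words in \<open>'g\<close>.
\<close>

instantiation list :: (type) monoid_add
begin

definition zero_list :: "'a list" where "zero_list = []"

definition plus_list :: "'a list \<Rightarrow> 'a list \<Rightarrow> 'a list" where "plus_list = (@)"

instance by standard (simp_all add: zero_list_def plus_list_def)

end

type_synonym ('g, 'f) falg = "'g list \<Rightarrow>\<^sub>0 'f"

definition scal :: "'f::zero \<Rightarrow> ('g, 'f) falg" where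
  "scal c = Poly_Mapping.single [] c"

definition wmon :: "'g list \<Rightarrow> ('g, 'f::zero_neq_one) falg" where
  "wmon w = Poly_Mapping.single w 1"

definition lin_ext :: "('g list \<Rightarrow> ('h, 'f) falg) \<Rightarrow> ('g, 'f::field) falg \<Rightarrow> ('h, 'f) falg" where
  "lin_ext f p = (\<Sum>w\<in>Poly_Mapping.keys p. scal (Poly_Mapping.lookup p w) * f w)"

definition alg_hom :: "(('g, 'f::field) falg \<Rightarrow> ('h, 'f) falg) \<Rightarrow> bool" where
  "alg_hom D \<longleftrightarrow> D 1 = 1 \<and> (\<forall>p q. D (p + q) = D p + D q) \<and> (\<forall>p q. D (p * q) = D p * D q) \<and>
     (\<forall>c p. D (scal c * p) = scal c * D p)"

definition alg_ext :: "('g \<Rightarrow> ('h, 'f) falg) \<Rightarrow> ('g, 'f::field) falg \<Rightarrow> ('h, 'f) falg" where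
  "alg_ext \<phi> = lin_ext (\<lambda>w. prod_list (map \<phi> w))"

lemma scal_1 [simp]: "scal 1 = (1 :: ('g, 'f::field) falg)"
  by (simp add: scal_def zero_list_def[symmetric])

lemma scal_0 [simp]: "scal 0 = (0 :: ('g, 'f::field) falg)"
  by (simp add: scal_def)

lemma scal_add: "scal (c + d) = scal c + (scal d :: ('g, 'f::field) falg)"
  by (simp add: scal_def single_add)

lemma scal_mult: "scal (c * d) = scal c * (scal d :: ('g, 'f::field) falg)"
  by (simp add: scal_def mult_single plus_list_def)

lemma wmon_Nil: "wmon [] = (1 :: ('g, 'f::field) falg)"
  by (simp add: wmon_def zero_list_def[symmetric])

lemma wmon_append: "wmon (v @ w) = (wmon v * wmon w :: ('g, 'f::field) falg)"
  by (simp add: wmon_def mult_single plus_list_def)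

lemma scal_wmon: "scal c * wmon w = Poly_Mapping.single w (c :: 'f::field)"
  by (simp add: scal_def wmon_def mult_single plus_list_def)

lemma falg_induct [case_names zero add]:
  fixes p :: "('g, 'f::field) falg"
  assumes "P 0" "\<And>c w q. P q \<Longrightarrow> P (scal c * wmon w + q)"
  shows "P p"
proof (induction p rule: update_induct)
  case const
  then show ?case using assms(1) by simp
next
  case (update f a b)
  have "Poly_Mapping.update a b f = scal b * wmon a + f"
    unfolding scal_wmon using update(1)
    by (intro poly_mapping_eqI)
      (auto simp: lookup_update lookup_add lookup_single when_def in_keys_iff)
  then show ?case using assms(2) update by simp
qed

lemma lin_ext_superset:
  assumes "finite S" "Poly_Mapping.keys p \<subseteq> S"
  shows "lin_ext f p = (\<Sum>w\<in>S. scal (Poly_Mapping.lookup p w) * f w)"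
  unfolding lin_ext_def using assms
  by (intro sum.mono_neutral_left) (auto simp: in_keys_iff)

lemma lin_ext_add: "lin_ext f (p + q) = lin_ext f p + lin_ext f q"
proof -
  let ?S = "Poly_Mapping.keys p \<union> Poly_Mapping.keys q"
  have "lin_ext f (p + q) = (\<Sum>w\<in>?S. scal (Poly_Mapping.lookup (p + q) w) * f w)"
    by (rule lin_ext_superset) (use Poly_Mapping.keys_add[of p q] in auto)
  also have "\<dots> = lin_ext f p + lin_ext f q"
    by (subst (1 2) lin_ext_superset[of ?S])
      (auto simp: lookup_add scal_add distrib_right sum.distrib)
  finally show ?thesis .
qed

lemma lin_ext_0 [simp]: "lin_ext f 0 = 0"
  by (simp add: lin_ext_def)

lemma lin_ext_scal_wmon: "lin_ext f (scal c * wmon w) = scal c * f w"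
  by (simp add: scal_wmon lin_ext_def)

lemma scal_commute: "scal c * p = p * (scal c :: ('g, 'f::field) falg)"
proof (induction p rule: falg_induct)
  case (add d w q)
  then show ?case
    by (simp add: distrib_left distrib_right scal_def wmon_def mult_single plus_list_def mult.commute)
qed simp

lemma scal_left_commute: "p * (scal c * q) = scal c * (p * q :: ('g, 'f::field) falg)"
  by (simp only: mult.assoc[symmetric] scal_commute[of c p])

lemma lin_ext_scal: "lin_ext f (scal c * p) = scal c * lin_ext f p"
proof (induction p rule: falg_induct)
  case (add d w q)
  have "lin_ext f (scal c * (scal d * wmon w)) = scal c * lin_ext f (scal d * wmon w)"
    by (simp only: lin_ext_scal_wmon mult.assoc[symmetric] scal_mult[symmetric])
  with add show ?case by (simp only: distrib_left lin_ext_add)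
qed simp

lemma lin_ext_mult_left: "lin_ext (\<lambda>w. q * f w) p = q * lin_ext f p"
  by (simp add: lin_ext_def sum_distrib_left scal_left_commute)

lemma lin_ext_mult_right: "lin_ext (\<lambda>w. f w * q) p = lin_ext f p * q"
  by (simp add: lin_ext_def sum_distrib_right mult.assoc)

lemma lin_ext_sum: "lin_ext (\<lambda>w. f w + g w) p = lin_ext f p + lin_ext g p"
  by (simp add: lin_ext_def distrib_left sum.distrib)

lemma lin_ext_wmon: "lin_ext f (wmon w) = f w"
  using lin_ext_scal_wmon[of f 1 w] by simp

lemma alg_ext_mult: "alg_ext \<phi> (p * q) = alg_ext \<phi> p * alg_ext \<phi> q"
proof (induction p rule: falg_induct)
  case zero
  then show ?case by (simp add: alg_ext_def)
next
  case (add c v p)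
  have "alg_ext \<phi> (wmon v * q) = alg_ext \<phi> (wmon v) * alg_ext \<phi> q"
  proof (induction q rule: falg_induct)
    case zero
    then show ?case by (simp add: alg_ext_def)
  next
    case (add d w q)
    have "alg_ext \<phi> (wmon v * (scal d * wmon w)) = alg_ext \<phi> (scal d * wmon (v @ w))"
      by (simp add: scal_left_commute wmon_append)
    also have "\<dots> = scal d * (prod_list (map \<phi> v) * prod_list (map \<phi> w))"
      by (simp add: alg_ext_def lin_ext_scal_wmon)
    also have "\<dots> = alg_ext \<phi> (wmon v) * alg_ext \<phi> (scal d * wmon w)"
      by (simp add: alg_ext_def lin_ext_wmon lin_ext_scal_wmon scal_left_commute)
    finally show ?case using add by (simp only: alg_ext_def lin_ext_add distrib_left)
  qed
  with add show ?case
    by (simp only: alg_ext_def lin_ext_add lin_ext_scal distrib_right mult.assoc)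
qed

text \<open>\<open>alg_ext \<phi>\<close> is the unique algebra homomorphism that extends \<open>\<phi>\<close>.\<close>

lemma alg_hom_alg_ext: "alg_hom (alg_ext \<phi>)"
  unfolding alg_hom_def
proof (intro conjI allI)
  show "alg_ext \<phi> 1 = 1"
    unfolding wmon_Nil[symmetric] alg_ext_def lin_ext_wmon by (simp add: wmon_Nil)
  show "alg_ext \<phi> (scal c * p) = scal c * alg_ext \<phi> p" for c p
    by (simp only: alg_ext_def lin_ext_scal)
qed (simp_all only: alg_ext_mult, simp_all only: alg_ext_def lin_ext_add)

lemma alg_ext_gen [simp]: "alg_ext \<phi> (wmon [g]) = \<phi> g"
  by (simp add: alg_ext_def lin_ext_wmon)

lemma alg_ext_unique:
  fixes D :: "('g, 'f::field) falg \<Rightarrow> ('h, 'f) falg"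
  assumes "alg_hom D" "\<And>g. D (wmon [g]) = \<phi> g"
  shows "D = alg_ext \<phi>"
proof
  fix p
  have w: "D (wmon w) = prod_list (map \<phi> w)" for w
  proof (induction w)
    case (Cons g w)
    have "wmon (g # w) = (wmon [g] * wmon w :: ('g, 'f) falg)"
      using wmon_append[of "[g]" w] by simp
    with Cons assms show ?case by (simp add: alg_hom_def)
  qed (use assms in \<open>simp add: wmon_Nil alg_hom_def\<close>)
  show "D p = alg_ext \<phi> p"
  proof (induction p rule: falg_induct)
    case zero
    have "D (0 + 0) = D 0 + D 0" using assms(1) unfolding alg_hom_def by blast
    then show ?case by (simp add: alg_ext_def)
  next
    case (add c w q)
    have "D (scal c * wmon w + q) = scal c * D (wmon w) + D q"
      using assms(1) unfolding alg_hom_def by metis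
    with add show ?case
      by (simp only: alg_ext_def lin_ext_add lin_ext_scal_wmon w)
  qed
qed


section \<open>Combinatorial data\<close>

definition comps :: "nat \<Rightarrow> nat \<Rightarrow> nat list set" where
  "comps n l = {ns. length ns = l \<and> (\<forall>k\<in>set ns. 0 < k) \<and> sum_list ns = n}"

definition Mset :: "nat \<Rightarrow> nat list set" where
  "Mset l = {ms. length ms = l \<and> sum_list ms = l \<and> (\<forall>j\<in>{1..l - 1}. j \<le> sum_list (take j ms))}"

definition Eset :: "nat \<Rightarrow> nat list set" where
  "Eset l = {es. length es = l \<and> set es \<subseteq> {1, 2}}"

definition MEset :: "nat list \<Rightarrow> nat list set" where
  "MEset es = {ms \<in> Mset (length es). \<forall>i<length es. es ! i = 2 \<longrightarrow> ms ! i = 0}"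

definition dcoeff :: "nat list \<Rightarrow> nat" where
  "dcoeff ns = (\<Sum>ms\<in>Mset (length ns). \<Prod>i<length ns. (ns ! i + 1) choose (ms ! i))"

definition decoeff :: "nat list \<Rightarrow> nat list \<Rightarrow> nat" where
  "decoeff es ns = (\<Sum>ms\<in>MEset es. \<Prod>i<length ns. (ns ! i + 1) choose (ms ! i))"

definition esign :: "nat list \<Rightarrow> 'a::ring_1" where
  "esign es = (-1) ^ (sum_list es - length es)"

lemma finite_bounded_lists: "finite {ns. length ns = l \<and> sum_list ns = (n::nat)}"
proof (rule finite_subset)
  show "{ns. length ns = l \<and> sum_list ns = n} \<subseteq> {ns. set ns \<subseteq> {..n} \<and> length ns = l}"
    by (auto intro: member_le_sum_list)
  show "finite {ns. set ns \<subseteq> {..n} \<and> length ns = l}"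
    by (rule finite_lists_length_eq) simp
qed

lemma finite_comps: "finite (comps n l)"
  by (rule finite_subset[OF _ finite_bounded_lists[of l n]]) (auto simp: comps_def)

lemma finite_Mset: "finite (Mset l)"
  by (rule finite_subset[OF _ finite_bounded_lists[of l l]]) (auto simp: Mset_def)

lemma finite_MEset: "finite (MEset es)"
  by (rule finite_subset[OF _ finite_Mset]) (auto simp: MEset_def)

lemma finite_Eset: "finite (Eset l)"
  using finite_lists_length_eq[of "{1, 2::nat}" l] by (simp add: Eset_def conj_commute)

lemma dcoeff_Nil: "dcoeff [] = 1"
proof -
  have "Mset 0 = {[]}" by (auto simp: Mset_def)
  then show ?thesis by (simp add: dcoeff_def)
qed


section \<open>The co-operations\<close>

typedef pnat = "{n::nat. 0 < n}"
  by auto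

text \<open>
  \<open>Abs_pnat n\<close>, and hence each generator below, is meaningful for \<open>n \<ge> 1\<close> only. In the free
  product of two copies of \<open>H\<close> the summand of \<open>pnat + pnat\<close> tells the copy.
\<close>

type_synonym 'f H = "(pnat, 'f) falg"
type_synonym 'f HH = "(pnat + pnat, 'f) falg"

definition hgen :: "nat \<Rightarrow> 'f::field H" where
  "hgen n = wmon [Abs_pnat n]"

definition xg :: "nat \<Rightarrow> 'f::field HH" where
  "xg n = wmon [Inl (Abs_pnat n)]"

definition yg :: "nat \<Rightarrow> 'f::field HH" where
  "yg n = wmon [Inr (Abs_pnat n)]"

definition xyg :: "nat \<Rightarrow> nat \<Rightarrow> 'f::field HH" where
  "xyg e n = (if e = 1 then xg n else yg n)"

definition ug :: "nat \<Rightarrow> 'f::field HH" where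
  "ug n = xg n - yg n"

definition vg :: "nat \<Rightarrow> 'f::field HH" where
  "vg n = yg n - xg n"

definition Delta_gen :: "nat \<Rightarrow> 'f::field HH" where
  "Delta_gen n = xg n + yg n +
     (\<Sum>l=1..n-1. \<Sum>ns\<in>comps n (l+1).
        of_nat ((ns ! 0 + 1) choose l) * xg (ns ! 0) * prod_list (map yg (tl ns)))"

definition delta_r_gen :: "nat \<Rightarrow> 'f::field HH" where
  "delta_r_gen n =
     (\<Sum>l=0..n-1. (-1) ^ l * (\<Sum>ns\<in>comps n (l+1).
        of_nat (dcoeff (take l ns)) * (xg (ns ! 0) - yg (ns ! 0)) * prod_list (map yg (tl ns))))"

definition delta_l_gen :: "nat \<Rightarrow> 'f::field HH" where
  "delta_l_gen n = (yg n - xg n) +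
     (\<Sum>l=1..n-1. (-1) ^ l * (\<Sum>ns\<in>comps n (l+1). \<Sum>es\<in>Eset l.
        esign es * of_nat (decoeff es (take l ns)) * prod_list (map2 xyg es (take l ns)) *
        (yg (ns ! l) - xg (ns ! l))))"

definition Delta :: "'f::field H \<Rightarrow> 'f HH" where
  "Delta = alg_ext (\<lambda>k. Delta_gen (Rep_pnat k))"

definition delta_r :: "'f::field H \<Rightarrow> 'f HH" where
  "delta_r = alg_ext (\<lambda>k. delta_r_gen (Rep_pnat k))"

definition delta_l :: "'f::field H \<Rightarrow> 'f HH" where
  "delta_l = alg_ext (\<lambda>k. delta_l_gen (Rep_pnat k))"

lemma alg_hom_eqI:
  assumes "alg_hom D" "alg_hom D'" "\<And>n. n \<ge> 1 \<Longrightarrow> D (hgen n) = D' (hgen n)"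
  shows "D = D'"
proof -
  have "D (wmon [k]) = D' (wmon [k])" for k
    using assms(3)[of "Rep_pnat k"] Rep_pnat[of k] by (simp add: hgen_def Rep_pnat_inverse)
  then show ?thesis
    using alg_ext_unique[OF assms(1), of "\<lambda>k. D' (wmon [k])"]
      alg_ext_unique[OF assms(2), of "\<lambda>k. D' (wmon [k])"] by simp
qed

lemma cooperations_alg_hom: "alg_hom Delta" "alg_hom delta_r" "alg_hom delta_l"
  by (simp_all add: Delta_def delta_r_def delta_l_def alg_hom_alg_ext)

lemma cooperations_hgen:
  assumes "n \<ge> 1"
  shows "Delta (hgen n) = Delta_gen n" "delta_r (hgen n) = delta_r_gen n"
    "delta_l (hgen n) = delta_l_gen n"
  using assms by (simp_all add: Delta_def delta_r_def delta_l_def hgen_def Abs_pnat_inverse)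


section \<open>The tensor algebra and the operators\<close>

text \<open>
  The free algebra on the set of words is the tensor algebra of the vector space spanned by the
  words: the basis element \<open>[w\<^sub>1, \<dots>, w\<^sub>l]\<close> is \<open>w\<^sub>1 \<otimes> \<cdots> \<otimes> w\<^sub>l\<close>, and the product is \<open>\<otimes>\<close>. It contains
  \<open>T(A)\<close>, for \<open>A\<close> the polynomials without constant term, as the subalgebra spanned by the lists of
  nonempty words; constants in tensor factors never occur when the operators below are applied to
  elements of \<open>A\<close>.
\<close>

type_synonym 'f TA = "((pnat + pnat) list, 'f) falg"

definition iota :: "'f::field HH \<Rightarrow> 'f TA" where
  "iota = lin_ext (\<lambda>w. wmon [w])"

definition tens :: "'f::field HH list \<Rightarrow> 'f TA" where
  "tens as = prod_list (map iota as)"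

fun lett_deg :: "pnat + pnat \<Rightarrow> nat" where
  "lett_deg (Inl k) = Rep_pnat k"
| "lett_deg (Inr k) = Rep_pnat k"

definition word_deg :: "(pnat + pnat) list \<Rightarrow> nat" where
  "word_deg w = sum_list (map lett_deg w)"

definition homog :: "nat \<Rightarrow> 'f::field HH \<Rightarrow> bool" where
  "homog d a \<longleftrightarrow> (\<forall>w\<in>Poly_Mapping.keys a. word_deg w = d)"

fun rhd_word :: "(pnat + pnat) list list \<Rightarrow> (pnat + pnat) list list \<Rightarrow> 'f::field HH" where
  "rhd_word (w # ws) vs =
     of_nat ((word_deg w + 1) choose (length (w # ws) + length vs - 1)) * wmon (concat (w # ws) @ concat vs)"
| "rhd_word [] [] = 1"
| "rhd_word [] [v] = wmon v"
| "rhd_word [] (v # v' # vs) = 0"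

definition rhd :: "'f::field TA \<Rightarrow> 'f TA \<Rightarrow> 'f HH"  (infix "\<rhd>" 68) where
  "s \<rhd> t = lin_ext (\<lambda>ws. lin_ext (\<lambda>vs. rhd_word ws vs) t) s"

text \<open>
  \<open>\<rhd>\<close> is the bilinear extension of its values on tensor products of words. It satisfies its
  formulas for tensor products of arbitrary (in the case of the first factor: homogeneous) elements:
\<close>

lemma rhd_bilinear:
  "(s + s') \<rhd> t = s \<rhd> t + s' \<rhd> t" "s \<rhd> (t + t') = s \<rhd> t + s \<rhd> t'"
  "(scal c * s) \<rhd> t = scal c * (s \<rhd> t)" "s \<rhd> (scal c * t) = scal c * (s \<rhd> t)"
  by (simp_all only: rhd_def lin_ext_add lin_ext_scal lin_ext_sum lin_ext_mult_left)

lemma prod_list_wmon: "prod_list (map wmon ws) = (wmon (concat ws) :: ('g, 'f::field) falg)"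
  by (induction ws) (simp_all add: wmon_Nil wmon_append)

lemma lin_ext_cong:
  "(\<And>w. w \<in> Poly_Mapping.keys p \<Longrightarrow> f w = g w) \<Longrightarrow> lin_ext f p = lin_ext g p"
  by (simp add: lin_ext_def)

lemma iota_wmon: "iota (wmon w) = wmon [w]"
  by (simp add: iota_def lin_ext_wmon)

lemma alg_ext_wmon_iota: "alg_ext wmon (iota a) = (a :: 'f::field HH)"
proof (induction a rule: falg_induct)
  case zero
  then show ?case by (simp add: iota_def alg_ext_def)
next
  case (add c w q)
  then show ?case
    by (simp add: iota_def alg_ext_def lin_ext_add lin_ext_scal lin_ext_wmon)
qed

lemma alg_ext_wmon_tens: "alg_ext wmon (tens as) = (prod_list as :: 'f::field HH)"
proof (induction as)
  case Nil
  then show ?case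
    using alg_hom_alg_ext[of "wmon :: _ \<Rightarrow> 'f HH"] by (simp add: tens_def alg_hom_def)
next
  case (Cons a as)
  then show ?case by (simp add: tens_def alg_ext_mult alg_ext_wmon_iota)
qed

lemma keys_iota: "Poly_Mapping.keys (iota a) \<subseteq> (\<lambda>w. [w]) ` Poly_Mapping.keys a"
  unfolding iota_def lin_ext_def scal_wmon
  by (rule order.trans[OF Poly_Mapping.keys_sum]) (auto split: if_splits)

lemma keys_tens: "vs \<in> Poly_Mapping.keys (tens as) \<Longrightarrow> length vs = length as"
proof (induction as arbitrary: vs)
  case Nil
  then show ?case by (simp add: tens_def zero_list_def)
next
  case (Cons a as)
  from Cons.prems have "vs \<in> Poly_Mapping.keys (iota a * tens as)"
    by (simp add: tens_def)
  then obtain u v where "vs = u @ v" "u \<in> Poly_Mapping.keys (iota a)" "v \<in> Poly_Mapping.keys (tens as)"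
    using Poly_Mapping.keys_mult[of "iota a" "tens as"] by (auto simp: plus_list_def)
  with Cons.IH keys_iota[of a] show ?case by auto
qed

lemma keys_tens_Cons:
  assumes "vs \<in> Poly_Mapping.keys (tens (a # as))"
  obtains w ws where "vs = w # ws" "w \<in> Poly_Mapping.keys a" "length ws = length as"
proof -
  from assms have "vs \<in> Poly_Mapping.keys (iota a * tens as)"
    by (simp add: tens_def)
  then obtain u v where "vs = u @ v" "u \<in> Poly_Mapping.keys (iota a)" "v \<in> Poly_Mapping.keys (tens as)"
    using Poly_Mapping.keys_mult[of "iota a" "tens as"] by (auto simp: plus_list_def)
  with keys_iota[of a] keys_tens[of v as] that show ?thesis by auto
qed

lemma rhd_homog:
  assumes "homog d a"
  shows "tens (a # as) \<rhd> tens bs =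
    of_nat ((d + 1) choose (length (a # as) + length bs - 1)) * (prod_list (a # as) * prod_list bs)"
proof -
  let ?c = "of_nat ((d + 1) choose (length (a # as) + length bs - 1)) :: 'a HH"
  have ext: "lin_ext (\<lambda>vs. wmon (concat vs)) t = alg_ext wmon t" for t :: "'a TA"
    by (simp add: alg_ext_def prod_list_wmon)
  have "tens (a # as) \<rhd> tens bs =
      lin_ext (\<lambda>ws. ?c * (wmon (concat ws) * prod_list bs)) (tens (a # as))"
    unfolding rhd_def
  proof (rule lin_ext_cong, erule keys_tens_Cons)
    fix us w ws
    assume us: "us = w # ws" "w \<in> Poly_Mapping.keys a" "length ws = length as"
    have "lin_ext (rhd_word us) (tens bs) =
        lin_ext (\<lambda>vs. ?c * wmon (concat us) * wmon (concat vs)) (tens bs)"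
    proof (rule lin_ext_cong)
      fix vs
      assume "vs \<in> Poly_Mapping.keys (tens bs)"
      then have "length vs = length bs" by (rule keys_tens)
      moreover have "word_deg w = d" using us assms by (simp add: homog_def)
      ultimately show "rhd_word us vs = ?c * wmon (concat us) * wmon (concat vs)"
        by (simp add: us wmon_append mult.assoc)
    qed
    also have "\<dots> = ?c * (wmon (concat us) * prod_list bs)"
      by (simp only: lin_ext_mult_left ext alg_ext_wmon_tens mult.assoc)
    finally show "lin_ext (rhd_word us) (tens bs) = ?c * (wmon (concat us) * prod_list bs)" .
  qed
  then show ?thesis
    by (simp only: lin_ext_mult_left lin_ext_mult_right ext alg_ext_wmon_tens)
qed

lemma rhd_one:
  fixes b :: "'f::field HH"
  shows "1 \<rhd> 1 = (1 :: 'f HH)" "1 \<rhd> iota b = b" "length bs > 1 \<Longrightarrow> 1 \<rhd> tens bs = (0 :: 'f HH)"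
proof -
  have 1: "1 \<rhd> t = lin_ext (rhd_word []) t" for t :: "'f TA"
    by (simp add: rhd_def wmon_Nil[symmetric] lin_ext_wmon)
  show "1 \<rhd> 1 = (1 :: 'f HH)"
    unfolding 1 by (simp add: wmon_Nil[symmetric, where 'g = "(pnat + pnat) list"] lin_ext_wmon)
  show "1 \<rhd> iota b = b"
  proof -
    have "lin_ext (rhd_word []) (iota b) = alg_ext wmon (iota b)"
      unfolding alg_ext_def using keys_iota[of b] by (intro lin_ext_cong) auto
    then show ?thesis unfolding 1 by (simp add: alg_ext_wmon_iota)
  qed
  show "1 \<rhd> tens bs = (0 :: 'f HH)" if "length bs > 1"
  proof -
    have "lin_ext (rhd_word []) (tens bs) = lin_ext (\<lambda>_. 0) (tens bs)"
    proof (rule lin_ext_cong)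
      fix vs
      assume "vs \<in> Poly_Mapping.keys (tens bs)"
      with keys_tens that have "length vs > 1" by metis
      then show "rhd_word [] vs = (0 :: 'f HH)"
        by (cases "([] :: (pnat + pnat) list list, vs)" rule: rhd_word.cases) auto
    qed
    then show ?thesis unfolding 1 by (simp add: lin_ext_def)
  qed
qed

text \<open>
  Each operator below is given as a multilinear function of the list of its arguments, which
  amounts to a linear map on tensors; its index \<open>l\<close> is the length of the list.
\<close>

function L_op :: "'f::field HH list \<Rightarrow> 'f TA" where
  "L_op as = (if as = [] then 1 else
     (\<Sum>i<length as. (-1) ^ (length as - 1 - i) *
        (iota (L_op (take i as) \<rhd> iota (as ! i)) * tens (drop (i+1) as))))"
  by auto
termination by (relation "measure length") auto

declare L_op.simps [simp del]

text \<open>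
  With 0-based lists, \<open>a\<^bsub>P\<^sub>i\<^sub>-\<^sub>1+1\<^esub>\<close> is \<open>as ! psum p i\<close>, for \<open>i\<close> running from \<open>0\<close> to \<open>j - 1\<close>, and
  \<open>block p i as\<close> is the list of the \<open>p\<^sub>i - 1\<close> entries following it.
\<close>

definition psum :: "nat list \<Rightarrow> nat \<Rightarrow> nat" where
  "psum p i = sum_list (take i p)"

definition block :: "nat list \<Rightarrow> nat \<Rightarrow> 'a list \<Rightarrow> 'a list" where
  "block p i as = take (p ! i - 1) (drop (psum p i + 1) as)"

lemma one_less_length: "as \<noteq> [] \<Longrightarrow> length as \<noteq> Suc 0 \<Longrightarrow> Suc 0 < length as"
  by (cases as) auto

lemma length_block_less: "as \<noteq> [] \<Longrightarrow> length (block p i as) < length as"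
  by (cases as) (auto simp: block_def min_def)

function R_op :: "'f::field HH list \<Rightarrow> 'f TA" where
  "R_op as = (if as = [] then 1 else
     (\<Sum>j=1..length as. \<Sum>p\<in>comps (length as) j.
        prod_list (map (\<lambda>i. iota (iota (as ! psum p i) \<rhd> R_op (block p i as))) [0..<j])))"
  by auto
termination by (relation "measure length") (auto simp: length_block_less)

declare R_op.simps [simp del]

function Re_op :: "nat list \<Rightarrow> 'f::field HH list \<Rightarrow> 'f TA" where
  "Re_op es as =
     (if length as = 0 then 1
      else if length as = 1 then (if es ! 0 = 1 then iota (as ! 0) else 0)
      else (\<Sum>j=1..length as. \<Sum>p\<in>comps (length as) j.
        iota (Re_op [es ! 0] [as ! 0] \<rhd> Re_op (block p 0 es) (block p 0 as)) *
        prod_list (map (\<lambda>i. iota (iota (as ! psum p i) \<rhd> Re_op (block p i es) (block p i as))) [1..<j])))"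
  by auto
termination by (relation "measure (length \<circ> snd)") (auto simp: length_block_less one_less_length)

declare Re_op.simps [simp del]

end

(*
  Identify m = (m_1, ..., m_l) with the lattice path having steps m_i - 1. Then M_l is the set of
  paths from 0 to 0 that never become negative, and d_l and d_l^e are weighted counts of such paths;
  restricting M_l to M_l^e amounts to replacing the weights binom(n_i + 1, m_i) by [m_i = 0] whenever
  e_i = 2.

  Cutting a path that starts with m_1 = j at its first passages to the levels j - 2, ..., 0 shows that
  d_l satisfies the recursion of R_l; the down-steps m_i = 0, of weight 1, correspond to the last
  letter of each block of the composition p.

  Cutting an unrestricted path at its first passage to -1 gives
    sum_{i <= l} d_i t^i (1 + t)^(-(n_1 + ... + n_{i+1} + i + 1)) = 1 mod t^(l+1),
  and the coefficient of t^l after multiplication by (1 + t)^(l-1) is, by upper negation of the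
  binomial coefficients, the alternating recursion of L_l.
*)
theory Submission
  imports Defs "HOL-Computational_Algebra.Formal_Power_Series"
begin

section \<open>Weighted lattice paths\<close>

text \<open>
  The truncated lower bound \<open>1 - k\<close> excludes steps from height \<open>k\<close> to \<open>-1\<close>; above the upper bound,
  the remaining steps cannot reach \<open>0\<close>.
\<close>

fun path_sum :: "nat \<Rightarrow> (nat \<Rightarrow> nat) list \<Rightarrow> nat" where
  "path_sum k [] = of_bool (k = 0)"
| "path_sum k (w # ws) = (\<Sum>m\<in>{1 - k..length ws + 1 - k}. w m * path_sum (k + m - 1) ws)"

lemma path_sum_eq_0: "length ws < k \<Longrightarrow> path_sum k ws = 0"
  by (induction ws arbitrary: k) auto

text \<open>The added terms vanish because their paths end up too high to return to 0. A bound
  \<open>B\<close> independent of the list lets sums over prefixes of different lengths be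
  interchanged.\<close>

lemma path_sum_Cons:
  assumes "length ws + 1 - k \<le> B"
  shows "path_sum k (w # ws) = (\<Sum>m\<in>{1 - k..B}. w m * path_sum (k + m - 1) ws)"
  unfolding path_sum.simps using assms
  by (intro sum.mono_neutral_left) (auto intro!: path_sum_eq_0)

text \<open>Cut a path from \<open>k + k' + 1\<close> to 0 at its first passage to level
  \<open>k'\<close>. The steps before the cut, lowered by \<open>k' + 1\<close>, form a path from
  \<open>k\<close> to 0; the cut is a down-step \<open>m = 0\<close> at position \<open>q\<close>,
  of weight 1; the rest is a path from \<open>k'\<close> to 0.\<close>

lemma path_sum_first_passage:
  assumes "\<forall>w\<in>set ws. w 0 = 1"
  shows "path_sum (k + k' + 1) ws =
    (\<Sum>q<length ws. path_sum k (take q ws) * path_sum k' (drop (Suc q) ws))"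
  using assms
proof (induction ws arbitrary: k)
  case (Cons w ws)
  let ?B = "length ws + 1"
  let ?c = "\<lambda>k. \<Sum>q<length ws. path_sum k (take q ws) * path_sum k' (drop (Suc q) ws)"
  have IH: "path_sum (k + k' + 1) ws = ?c k" for k
    using Cons by simp
  have "(\<Sum>q<length (w # ws). path_sum k (take q (w # ws)) * path_sum k' (drop (Suc q) (w # ws)))
      = of_bool (k = 0) * path_sum k' ws +
        (\<Sum>q<length ws. path_sum k (w # take q ws) * path_sum k' (drop (Suc q) ws))"
    by (simp add: sum.lessThan_Suc_shift del: path_sum.simps(2) sum.lessThan_Suc)
  also have "(\<Sum>q<length ws. path_sum k (w # take q ws) * path_sum k' (drop (Suc q) ws)) =
      (\<Sum>q<length ws. \<Sum>m\<in>{1 - k..?B}. w m * path_sum (k + m - 1) (take q ws) * path_sum k' (drop (Suc q) ws))"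
    by (intro sum.cong refl, subst path_sum_Cons[where B = ?B])
      (auto simp: sum_distrib_right simp del: sum.cl_ivl_Suc)
  also have "\<dots> = (\<Sum>m\<in>{1 - k..?B}. w m * ?c (k + m - 1))"
    by (subst sum.swap) (simp add: sum_distrib_left mult.assoc)
  also have "\<dots> = (\<Sum>m\<in>{1 - k..?B}. w m * path_sum (k + k' + m) ws)"
  proof (intro sum.cong refl)
    fix m assume "m \<in> {1 - k..?B}"
    then have "k + m - 1 + k' + 1 = k + k' + m" by auto
    then show "w m * ?c (k + m - 1) = w m * path_sum (k + k' + m) ws"
      by (simp only: IH[symmetric])
  qed
  \<comment> \<open>The first summand is the cut at \<open>q = 0\<close>. For \<open>k = 0\<close>
    it supplies the missing \<open>m = 0\<close>; for \<open>k > 0\<close> it vanishes and the range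
    already starts at 0.\<close>
  also have "of_bool (k = 0) * path_sum k' ws + \<dots> = (\<Sum>m\<in>{0..?B}. w m * path_sum (k + k' + m) ws)"
    using Cons.prems by (cases k) (simp_all add: sum.atLeast_Suc_atMost[of 0])
  also have "\<dots> = path_sum (k + k' + 1) (w # ws)"
    by (subst path_sum_Cons[where B = ?B]) auto
  finally show ?case by simp
qed simp

section \<open>Compositions and the splitting of a path into blocks\<close>

lemma comps_0: "comps n 0 = (if n = 0 then {[]} else {})"
  by (auto simp: comps_def)

lemma comps_Suc: "comps n (Suc j) = (\<Union>x\<in>{1..n}. (#) x ` comps (n - x) j)"
proof (intro set_eqI iffI)
  fix p assume p: "p \<in> comps n (Suc j)"
  from p obtain x p' where "p = x # p'" by (cases p) (auto simp: comps_def)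
  with p show "p \<in> (\<Union>x\<in>{1..n}. (#) x ` comps (n - x) j)"
    by (intro UN_I[of x] imageI) (auto simp: comps_def)
qed (auto simp: comps_def)

lemma sum_comps_Suc:
  "(\<Sum>p\<in>comps n (Suc j). f p) = (\<Sum>x=1..n. \<Sum>p\<in>comps (n - x) j. f (x # p))"
  unfolding comps_Suc
  by (subst sum.UNION_disjoint) (auto simp: finite_comps sum.reindex)

lemma comps_0_Suc [simp]: "comps 0 (Suc j) = {}"
  by (simp add: comps_Suc)

lemma comps_1: "n > 0 \<Longrightarrow> comps n (Suc 0) = {[n]}"
  by (force simp: comps_Suc comps_0 split: if_splits)

lemma psum_0 [simp]: "psum p 0 = 0"
  by (simp add: psum_def)

lemma psum_Cons_Suc [simp]: "psum (x # p) (Suc i) = x + psum p i"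
  by (simp add: psum_def)

text \<open>Iterating the first-passage cut at the levels \<open>j - 1\<close>, ..., 0 leaves
  \<open>j + 1\<close> excursions from 0 to 0. Block \<open>i\<close> has length
  \<open>p ! i\<close>: an excursion of \<open>p ! i - 1\<close> steps and the down-step closing it.
  The last block is closed by a fictitious down-step to -1, whence the \<open>Suc\<close> in
  \<open>Suc (length ws)\<close>.\<close>

lemma path_sum_blocks:
  assumes "\<forall>w\<in>set ws. w 0 = 1"
  shows "path_sum j ws = (\<Sum>p\<in>comps (Suc (length ws)) (Suc j).
    \<Prod>i<Suc j. path_sum 0 (take (p ! i - 1) (drop (psum p i) ws)))"
  using assms
proof (induction j arbitrary: ws)
  case 0
  then show ?case by (simp add: comps_1)
next
  case (Suc j)
  let ?n = "Suc (length ws)"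
  let ?P = "\<lambda>p ws. \<Prod>i<Suc j. path_sum 0 (take (p ! i - 1) (drop (psum p i) ws))"
  have "(\<Sum>p\<in>comps ?n (Suc (Suc j)). \<Prod>i<Suc (Suc j). path_sum 0 (take (p ! i - 1) (drop (psum p i) ws)))
      = (\<Sum>x=1..?n. \<Sum>p\<in>comps (?n - x) (Suc j). path_sum 0 (take (x - 1) ws) * ?P p (drop x ws))"
    unfolding sum_comps_Suc[of _ _ "Suc j"] prod.lessThan_Suc_shift[of _ "Suc j"]
    by (simp add: add.commute)
  \<comment> \<open>The term \<open>x = ?n\<close> is empty: nothing would be left for the other
    blocks.\<close>
  also have "\<dots> = (\<Sum>x=1..length ws. \<Sum>p\<in>comps (?n - x) (Suc j). path_sum 0 (take (x - 1) ws) * ?P p (drop x ws))"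
    by simp
  also have "\<dots> = (\<Sum>x=1..length ws. path_sum 0 (take (x - 1) ws) * path_sum j (drop x ws))"
  proof (intro sum.cong refl)
    fix x assume x: "x \<in> {1..length ws}"
    then have "\<forall>w\<in>set (drop x ws). w 0 = 1" using Suc.prems in_set_dropD by metis
    from Suc.IH[OF this] x show "(\<Sum>p\<in>comps (?n - x) (Suc j). path_sum 0 (take (x - 1) ws) * ?P p (drop x ws)) =
        path_sum 0 (take (x - 1) ws) * path_sum j (drop x ws)"
      by (simp add: sum_distrib_left Suc_diff_le del: prod.lessThan_Suc)
  qed
  also have "\<dots> = (\<Sum>q<length ws. path_sum 0 (take q ws) * path_sum j (drop (Suc q) ws))"
    by (rule sum.reindex_bij_witness[of _ Suc "\<lambda>x. x - 1"]) auto
  also have "\<dots> = path_sum (Suc j) ws"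
    using path_sum_first_passage[OF Suc.prems, of 0 j] by simp
  finally show ?case by simp
qed

text \<open>A first step \<open>m = j\<close> leads from 0 to \<open>j - 1\<close>, so the rest of
  the path splits into \<open>j\<close> blocks. This is the shape of the recursion of R_l.\<close>

lemma path_sum_0_Cons_blocks:
  assumes "\<forall>w\<in>set ws. w 0 = 1"
  shows "path_sum 0 (w # ws) = (\<Sum>j=1..Suc (length ws). w j * (\<Sum>p\<in>comps (Suc (length ws)) j.
    \<Prod>i<j. path_sum 0 (take (p ! i - 1) (drop (psum p i) ws))))"
proof -
  have "w j * path_sum (0 + j - 1) ws = w j * (\<Sum>p\<in>comps (Suc (length ws)) j.
    \<Prod>i<j. path_sum 0 (take (p ! i - 1) (drop (psum p i) ws)))" if "j \<ge> 1" for j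
    using path_sum_blocks[OF assms, of "j - 1"] that by simp
  then show ?thesis
    unfolding One_nat_def
    by (subst path_sum_Cons[where B = "Suc (length ws)"]) (auto intro!: sum.cong simp del: sum.cl_ivl_Suc prod.lessThan_Suc)
qed

section \<open>The coefficients d_l and d_l^e as weighted path counts\<close>

definition wt :: "nat \<Rightarrow> nat \<Rightarrow> nat \<Rightarrow> nat" where
  "wt e n m = (if e = 2 then of_bool (m = 0) else (n + 1) choose m)"

lemma wt_0 [simp]: "wt e n 0 = 1"
  by (simp add: wt_def)

text \<open>Generalises \<open>Mset\<close> to an arbitrary starting height \<open>k\<close>, so
  that removing the first step stays within the family; \<open>paths 0 l\<close> is
  \<open>Mset l\<close>.\<close>

definition paths :: "nat \<Rightarrow> nat \<Rightarrow> nat list set" where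
  "paths k l = {ms. length ms = l \<and> k + sum_list ms = l \<and> (\<forall>j\<in>{1..l - 1}. j \<le> k + sum_list (take j ms))}"

lemma finite_paths: "finite (paths k l)"
  by (rule finite_subset[OF _ finite_bounded_lists[of l "l - k"]]) (auto simp: paths_def)

lemma paths_0: "paths k 0 = (if k = 0 then {[]} else {})"
  by (auto simp: paths_def)

lemma Cons_in_paths:
  "m # ms \<in> paths k (Suc l) \<longleftrightarrow> m \<in> {1 - k..l + 1 - k} \<and> ms \<in> paths (k + m - 1) l"
proof
  assume *: "m # ms \<in> paths k (Suc l)"
  then have len: "length ms = l" and sm: "k + m + sum_list ms = Suc l"
    and j: "\<And>j. j \<in> {1..l} \<Longrightarrow> j \<le> k + sum_list (take j (m # ms))"
    by (auto simp: paths_def)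
  \<comment> \<open>For \<open>l = 0\<close> there is no condition on partial sums, and the total
    sum gives the bound.\<close>
  have km: "1 \<le> k + m"
    using j[of 1] len sm by (cases l) auto
  have "j \<le> (k + m - 1) + sum_list (take j ms)" if "j \<in> {1..l - 1}" for j
  proof -
    have "Suc j \<in> {1..l}" using that by auto
    from j[OF this] km show ?thesis by simp
  qed
  with len sm km show "m \<in> {1 - k..l + 1 - k} \<and> ms \<in> paths (k + m - 1) l"
    by (auto simp: paths_def)
next
  assume *: "m \<in> {1 - k..l + 1 - k} \<and> ms \<in> paths (k + m - 1) l"
  have "j \<le> k + sum_list (take j (m # ms))" if j: "j \<in> {1..l}" for j
  proof (cases "j = 1")
    case True
    then show ?thesis using * by auto
  next
    case False
    then obtain i where "j = Suc i" "i \<in> {1..l - 1}"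
      using j by (cases j) auto
    moreover from this * have "i \<le> k + m - 1 + sum_list (take i ms)"
      by (simp add: paths_def)
    ultimately show ?thesis using * by auto
  qed
  with * show "m # ms \<in> paths k (Suc l)"
    by (auto simp: paths_def)
qed

lemma paths_Suc: "paths k (Suc l) = (\<Union>m\<in>{1 - k..l + 1 - k}. (#) m ` paths (k + m - 1) l)"
proof (rule set_eqI)
  fix p
  show "p \<in> paths k (Suc l) \<longleftrightarrow> p \<in> (\<Union>m\<in>{1 - k..l + 1 - k}. (#) m ` paths (k + m - 1) l)"
    by (cases p) (auto simp: Cons_in_paths simp del: atLeastAtMost_iff, simp add: paths_def)
qed

lemma sum_paths: "(\<Sum>ms\<in>paths k (length ws). \<Prod>i<length ws. (ws ! i) (ms ! i)) = path_sum k ws"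
proof (induction ws arbitrary: k)
  case (Cons w ws)
  then show ?case
    unfolding list.size paths_Suc add_Suc_right add_0_right
    by (subst sum.UNION_disjoint)
      (auto simp: finite_paths sum.reindex prod.lessThan_Suc_shift sum_distrib_left[symmetric] simp del: prod.lessThan_Suc)
qed (simp add: paths_0)

lemma decoeff_eq_path_sum:
  assumes "length es = length ns"
  shows "decoeff es ns = path_sum 0 (map2 wt es ns)"
proof -
  let ?ws = "map2 wt es ns"
  have "paths 0 (length ns) = Mset (length ns)" by (simp add: paths_def Mset_def)
  then have "path_sum 0 ?ws = (\<Sum>ms\<in>Mset (length es). \<Prod>i<length ns. (?ws ! i) (ms ! i))"
    using sum_paths[of ?ws 0] assms by simp
  \<comment> \<open>A sequence outside \<open>MEset es\<close> has a factor \<open>wt 2 n m\<close>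
    with \<open>m\<close> nonzero, which is 0.\<close>
  also have "\<dots> = (\<Sum>ms\<in>MEset es. \<Prod>i<length ns. (?ws ! i) (ms ! i))"
    using assms by (intro sum.mono_neutral_right) (auto simp: MEset_def finite_Mset wt_def)
  also have "\<dots> = decoeff es ns"
    unfolding decoeff_def using assms
    by (intro sum.cong prod.cong refl) (auto simp: MEset_def wt_def)
  finally show ?thesis by simp
qed

lemma dcoeff_eq_decoeff: "dcoeff ns = decoeff (replicate (length ns) 1) ns"
  by (simp add: dcoeff_def decoeff_def MEset_def)

lemma dcoeff_eq_path_sum: "dcoeff ns = path_sum 0 (map (wt 1) ns)"
  by (simp add: dcoeff_eq_decoeff decoeff_eq_path_sum zip_replicate1 comp_def)

text \<open>By Vandermonde the right side is the weighted count of all step sequences from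
  \<open>k\<close> to 0, negative heights allowed. Those that stay nonnegative give
  \<open>path_sum k\<close>. The others first reach -1 by a down-step at some position
  \<open>i\<close>; before it lies a path from \<open>k\<close> to 0, and the remaining
  \<open>length ns - i - 1\<close> steps must climb from -1 to 0, so their \<open>m\<close> sum to
  \<open>length ns - i\<close>.\<close>

lemma path_sum_unrestricted:
  assumes "k \<le> length ns"
  shows "path_sum k (map (wt 1) ns) + (\<Sum>i<length ns. path_sum k (map (wt 1) (take i ns)) *
      (sum_list (map Suc (drop (Suc i) ns)) choose (length ns - i))) =
    sum_list (map Suc ns) choose (length ns - k)"
  using assms
proof (induction ns arbitrary: k)
  case (Cons n ns)
  let ?M = "\<lambda>ns. sum_list (map Suc ns)"
  let ?l = "length ns"
  let ?B = "?l + 1 - k"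
  let ?G = "\<lambda>k ns. path_sum k (map (wt 1) ns)"
  let ?S = "\<lambda>k. \<Sum>i<?l. ?G k (take i ns) * (?M (drop (Suc i) ns) choose (?l - i))"
  have "?M (n # ns) choose (Suc ?l - k) = (\<Sum>m\<in>{0..?B}. (Suc n choose m) * (?M ns choose (?B - m)))"
    using vandermonde[of "Suc n" "?M ns" "Suc ?l - k"] by (simp add: atLeast0AtMost)
  \<comment> \<open>For \<open>k = 0\<close> the choice \<open>m = 0\<close> goes straight to -1;
    this becomes the summand \<open>i = 0\<close> of the claim.\<close>
  also have "\<dots> = of_bool (k = 0) * (?M ns choose Suc ?l) +
      (\<Sum>m\<in>{1 - k..?B}. (Suc n choose m) * (?M ns choose (?B - m)))"
    by (cases k) (simp_all add: sum.atLeast_Suc_atMost[of 0] del: sum.cl_ivl_Suc)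
  also have "(\<Sum>m\<in>{1 - k..?B}. (Suc n choose m) * (?M ns choose (?B - m))) =
      (\<Sum>m\<in>{1 - k..?B}. wt 1 n m * (?G (k + m - 1) ns + ?S (k + m - 1)))"
  proof (intro sum.cong refl)
    fix m assume m: "m \<in> {1 - k..?B}"
    then have le: "k + m - 1 \<le> ?l" and eq: "?B - m = ?l - (k + m - 1)"
      using Cons.prems by auto
    have "?G (k + m - 1) ns + ?S (k + m - 1) = ?M ns choose (?l - (k + m - 1))"
      using le by (rule Cons.IH)
    then show "(Suc n choose m) * (?M ns choose (?B - m)) = wt 1 n m * (?G (k + m - 1) ns + ?S (k + m - 1))"
      unfolding eq by (simp only: wt_def) simp
  qed
  also have "\<dots> = ?G k (n # ns) + (\<Sum>i<?l. ?G k (n # take i ns) * (?M (drop (Suc i) ns) choose (?l - i)))"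
  proof -
    have "(\<Sum>m\<in>{1 - k..?B}. wt 1 n m * ?S (k + m - 1)) =
        (\<Sum>i<?l. (\<Sum>m\<in>{1 - k..?B}. wt 1 n m * ?G (k + m - 1) (take i ns)) * (?M (drop (Suc i) ns) choose (?l - i)))"
      unfolding sum_distrib_left sum_distrib_right by (subst sum.swap) (simp add: mult.assoc)
    also have "\<dots> = (\<Sum>i<?l. ?G k (n # take i ns) * (?M (drop (Suc i) ns) choose (?l - i)))"
      unfolding list.map
      by (intro sum.cong refl, subst path_sum_Cons[where B = ?B]) auto
    finally show ?thesis by (simp add: distrib_left sum.distrib del: sum.cl_ivl_Suc)
  qed
  finally show ?case
    by (simp add: sum.lessThan_Suc_shift del: path_sum.simps(2) sum.lessThan_Suc binomial_Suc_Suc)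
qed simp

section \<open>The alternating recursion\<close>

text \<open>The count of unrestricted paths from height 0, for the prefix of length
  \<open>L\<close>. The paths that never become negative are absorbed as the summand
  \<open>i = L\<close>, whose binomial coefficient has lower index 0.\<close>

lemma dcoeff_unrestricted:
  assumes "L \<le> length ns"
  shows "(\<Sum>i\<le>L. dcoeff (take i ns) * (sum_list (map Suc (take (L - Suc i) (drop (Suc i) ns))) choose (L - i))) =
    sum_list (map Suc (take L ns)) choose L"
proof -
  have "dcoeff (take L ns) + (\<Sum>i<L. dcoeff (take i ns) *
      (sum_list (map Suc (take (L - Suc i) (drop (Suc i) ns))) choose (L - i))) =
      sum_list (map Suc (take L ns)) choose L"
    using path_sum_unrestricted[of 0 "take L ns"] assms
    by (simp add: dcoeff_eq_path_sum drop_take)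
  then show ?thesis
    by (simp add: lessThan_Suc_atMost[symmetric] add.commute)
qed

lemma sum_list_map_Suc: "sum_list (map Suc xs) = sum_list xs + length xs"
  by (induction xs) auto

text \<open>Carried out over the rationals, because the binomial series has negative exponents and
  needs characteristic 0.\<close>

lemma dcoeff_alternating:
  includes fps_syntax
  assumes "ns \<noteq> []"
  shows "(\<Sum>i\<le>length ns. (-1) ^ (length ns - i) *
    (rat_of_nat (dcoeff (take i ns)) * of_nat ((sum_list (take (Suc i) ns) + 1) choose (length ns - i)))) = 0"
proof -
  let ?l = "length ns"
  let ?B = "fps_binomial :: rat \<Rightarrow> rat fps"
  define N where "N i = rat_of_nat (sum_list (take i ns))" for i
  \<comment> \<open>For \<open>i = ?l\<close> the prefix \<open>take (Suc i) ns\<close> is just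
    \<open>ns\<close>. Modulo t^(l+1) only the constant term of that binomial series enters
    \<open>S\<close>, so the value of the exponent there does not affect the result.\<close>
  define a where "a i = N (Suc i) + of_nat i + 1" for i
  define S where "S = (\<Sum>i\<le>?l. fps_const (of_nat (dcoeff (take i ns))) * (fps_X ^ i * ?B (- a i)))"
  have S: "(?B c * S) $ L = (\<Sum>i\<le>L. of_nat (dcoeff (take i ns)) * ((c - a i) gchoose (L - i)))"
    if "L \<le> ?l" for c L
  proof -
    have "?B c * S = (\<Sum>i\<le>?l. fps_const (of_nat (dcoeff (take i ns))) * (fps_X ^ i * ?B (c - a i)))"
      unfolding S_def sum_distrib_left
      by (intro sum.cong refl)
        (simp only: diff_conv_add_uminus[of c] fps_binomial_add_mult mult.left_commute)
    then have "(?B c * S) $ L =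
        (\<Sum>i\<le>?l. of_nat (dcoeff (take i ns)) * (if L < i then 0 else (c - a i) gchoose (L - i)))"
      by (simp add: fps_sum_nth fps_X_power_mult_nth cong: if_cong)
    also have "\<dots> = (\<Sum>i\<le>L. of_nat (dcoeff (take i ns)) * ((c - a i) gchoose (L - i)))"
      using that by (intro sum.mono_neutral_cong_right) auto
    finally show ?thesis .
  qed
  \<comment> \<open>The exponent is the sum of \<open>n + 1\<close> over the first \<open>L\<close>
    entries. For \<open>i < L\<close>, subtracting \<open>a i\<close> leaves this sum over the steps
    after the cut, which is the upper index in \<open>dcoeff_unrestricted\<close>.\<close>
  have coeff_L: "(?B (N L + of_nat L) * S) $ L = ?B (N L + of_nat L) $ L" if L: "L \<le> ?l" for L
  proof -
    have "(N L + of_nat L - a i) gchoose (L - i) =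
        of_nat (sum_list (map Suc (take (L - Suc i) (drop (Suc i) ns))) choose (L - i))" if i: "i \<le> L" for i
    proof (cases "i = L")
      case False
      then have iL: "i < L" using i by simp
      have "take L ns = take (Suc i) ns @ take (L - Suc i) (drop (Suc i) ns)"
        using iL take_add[of "Suc i" "L - Suc i" ns] by simp
      then have "sum_list (take L ns) = sum_list (take (Suc i) ns) + sum_list (take (L - Suc i) (drop (Suc i) ns))"
        by simp
      then have "N L + of_nat L - a i = of_nat (sum_list (map Suc (take (L - Suc i) (drop (Suc i) ns))))"
        using iL L by (simp add: N_def a_def sum_list_map_Suc of_nat_diff)
      then show ?thesis by (simp add: binomial_gbinomial)
    qed simp
    then have "(?B (N L + of_nat L) * S) $ L = of_nat (\<Sum>i\<le>L. dcoeff (take i ns) *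
        (sum_list (map Suc (take (L - Suc i) (drop (Suc i) ns))) choose (L - i)))"
      using S[OF L] by simp
    also have "\<dots> = ?B (N L + of_nat L) $ L"
      unfolding dcoeff_unrestricted[OF L] using L
      by (simp add: binomial_gbinomial N_def sum_list_map_Suc)
    finally show ?thesis .
  qed
  \<comment> \<open>The multiplier in \<open>coeff_L\<close> changes with \<open>L\<close>, but its
    constant term is always 1; once the lower coefficients of \<open>S - 1\<close> vanish, so does
    the one at \<open>L\<close>.\<close>
  have S_1: "(S - 1) $ L = 0" if "L \<le> ?l" for L
    using that
  proof (induction L rule: less_induct)
    case (less L)
    let ?b = "?B (N L + of_nat L)"
    have "0 = (?b * (S - 1)) $ L"
      using coeff_L[OF less.prems] by (simp add: right_diff_distrib)
    also have "\<dots> = (\<Sum>i=0..L. ?b $ i * (S - 1) $ (L - i))"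
      by (rule fps_mult_nth)
    also have "\<dots> = (\<Sum>i\<in>{0}. ?b $ i * (S - 1) $ (L - i))"
      using less by (intro sum.mono_neutral_right) auto
    finally show ?case by simp
  qed
  \<comment> \<open>This exponent serves twice: \<open>(?l - 1) choose ?l\<close> is 0, and upper
    negation turns the binomial with upper argument \<open>?l - 1 - a i\<close> into the one of the
    claim, up to sign.\<close>
  let ?b = "?B (of_nat (?l - 1))"
  have "(?b * (S - 1)) $ ?l = 0"
    unfolding fps_mult_nth using S_1 by (intro sum.neutral) auto
  then have "(?b * S) $ ?l = of_nat (?l - 1) gchoose ?l"
    by (simp add: right_diff_distrib)
  also have "\<dots> = of_nat ((?l - 1) choose ?l)"
    by (rule binomial_gbinomial[symmetric])
  also have "\<dots> = 0"
    using assms by (simp add: binomial_eq_0)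
  finally have "(\<Sum>i\<le>?l. of_nat (dcoeff (take i ns)) * ((of_nat (?l - 1) - a i) gchoose (?l - i))) = 0"
    unfolding S[OF order.refl] .
  moreover have "(of_nat (?l - 1) - a i) gchoose (?l - i) =
      (-1) ^ (?l - i) * of_nat ((sum_list (take (Suc i) ns) + 1) choose (?l - i))" if i: "i \<le> ?l" for i
  proof -
    have "?l \<ge> 1" using assms by (cases ns) auto
    then have "of_nat (?l - 1) - a i = of_nat (?l - i) - of_nat (sum_list (take (Suc i) ns) + 1) - 1"
      using i by (simp add: a_def N_def of_nat_diff)
    then have "((-1) ^ (?l - i) * (-1) ^ (?l - i)) * ((of_nat (?l - 1) - a i) gchoose (?l - i)) =
        (-1) ^ (?l - i) * of_nat ((sum_list (take (Suc i) ns) + 1) choose (?l - i))"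
      unfolding binomial_gbinomial by (subst (2) gbinomial_negated_upper) (simp only: mult.assoc)
    then show ?thesis
      by (simp add: power_add[symmetric] mult_2[symmetric])
  qed
  ultimately show ?thesis
    by (simp add: mult.left_commute)
qed

text \<open>Isolates the summand \<open>i = length ns\<close> of the alternating sum. The rational
  identity is one between integers, hence maps to every ring, in particular to fields of any
  characteristic.\<close>

lemma dcoeff_recursion:
  assumes "ns \<noteq> []"
  shows "(\<Sum>i<length ns. (-1) ^ (length ns - 1 - i) *
    (of_nat (dcoeff (take i ns)) * of_nat ((sum_list (take (Suc i) ns) + 1) choose (length ns - i)))) =
    (of_nat (dcoeff ns) :: 'a::ring_1)"
proof -
  let ?l = "length ns"
  let ?f = "\<lambda>i. int (dcoeff (take i ns)) * int ((sum_list (take (Suc i) ns) + 1) choose (?l - i))"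
  have "rat_of_int (\<Sum>i\<le>?l. (-1) ^ (?l - i) * ?f i) = 0"
    using dcoeff_alternating[OF assms] by simp
  then have "(\<Sum>i\<le>?l. (-1) ^ (?l - i) * ?f i) = 0"
    by (simp only: of_int_eq_0_iff)
  then have "int (dcoeff ns) + (\<Sum>i<?l. (-1) ^ (?l - i) * ?f i) = 0"
    by (simp add: lessThan_Suc_atMost[symmetric] add.commute)
  moreover have "(\<Sum>i<?l. (-1) ^ (?l - i) * ?f i) = - (\<Sum>i<?l. (-1) ^ (?l - 1 - i) * ?f i)"
    unfolding sum_negf[symmetric]
  proof (intro sum.cong refl)
    fix i assume "i \<in> {..<?l}"
    then have "?l - i = Suc (?l - 1 - i)" by auto
    then show "(-1) ^ (?l - i) * ?f i = - ((-1) ^ (?l - 1 - i) * ?f i)"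
      by (simp only: power_Suc mult_minus_left mult_1)
  qed
  ultimately have "(\<Sum>i<?l. (-1) ^ (?l - 1 - i) * ?f i) = int (dcoeff ns)"
    by simp
  then have "of_int (\<Sum>i<?l. (-1) ^ (?l - 1 - i) * ?f i) = (of_int (int (dcoeff ns)) :: 'a)"
    by (rule arg_cong)
  then show ?thesis by simp
qed

section \<open>The operators on homogeneous elements\<close>

lemma scal_sum: "(\<Sum>i\<in>A. scal (f i)) = (scal (sum f A) :: ('g, 'f::field) falg)"
  by (induction A rule: infinite_finite_induct) (simp_all add: scal_add)

lemma scal_of_nat: "of_nat n = (scal (of_nat n) :: ('g, 'f::field) falg)"
  by (induction n) (simp_all add: scal_add)

lemma scal_minus: "scal (- c) = (- scal c :: ('g, 'f::field) falg)"
  using scal_add[of c "- c", where ?'g = 'g] by (simp add: eq_neg_iff_add_eq_0 add.commute)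

lemma scal_minus_one_power: "(-1) ^ n = (scal ((-1) ^ n) :: ('g, 'f::field) falg)"
  by (induction n) (simp_all add: scal_minus)

lemma scal_scal: "scal c * (scal d * p) = scal (c * d) * (p :: ('g, 'f::field) falg)"
  by (simp only: scal_mult mult.assoc)

lemma rhd_zero [simp]: "0 \<rhd> t = 0" "s \<rhd> 0 = 0"
  using rhd_bilinear(1)[of 0 0 t] rhd_bilinear(2)[of s 0 0] by simp_all

lemma rhd_sum_left: "sum f A \<rhd> t = (\<Sum>x\<in>A. f x \<rhd> t)"
  by (induction A rule: infinite_finite_induct) (simp_all add: rhd_bilinear)

lemma rhd_sum_right: "s \<rhd> sum f A = (\<Sum>x\<in>A. s \<rhd> f x)"
  by (induction A rule: infinite_finite_induct) (simp_all add: rhd_bilinear)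

lemma iota_zero [simp]: "iota 0 = 0"
  by (simp add: iota_def)

lemma iota_scal: "iota (scal c * a) = scal c * iota a"
  by (simp add: iota_def lin_ext_scal)

lemma tens_Nil [simp]: "tens [] = 1"
  by (simp add: tens_def)

lemma tens_Cons: "tens (a # as) = iota a * tens as"
  by (simp add: tens_def)

lemma iota_eq_tens: "iota a = tens [a]"
  by (simp add: tens_def)

text \<open>On every word the binomial coefficient has lower index 0, so the degree does not
  enter.\<close>

lemma iota_rhd_one: "iota a \<rhd> 1 = (a :: 'f::field HH)"
proof (induction a rule: falg_induct)
  case (add c w q)
  have "iota (wmon w) \<rhd> 1 = (wmon w :: 'f HH)"
    by (simp add: iota_wmon rhd_def wmon_Nil[symmetric, where 'g = "(pnat + pnat) list"] lin_ext_wmon)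
  moreover have "iota (scal c * wmon w + q) = scal c * iota (wmon w) + iota q"
    by (simp add: iota_def lin_ext_add lin_ext_scal)
  ultimately show ?case
    using add by (simp add: rhd_bilinear)
qed simp

lemma iota_rhd_tens:
  assumes "homog d a"
  shows "iota a \<rhd> tens bs = scal (of_nat ((d + 1) choose length bs)) * (a * prod_list bs)"
  using rhd_homog[OF assms, of "[]" bs] by (simp add: iota_eq_tens scal_of_nat)

lemma homog_one: "homog 0 1"
  by (simp add: homog_def zero_list_def word_deg_def)

lemma homog_mult:
  assumes "homog d a" "homog e b"
  shows "homog (d + e) (a * b)"
  using assms Poly_Mapping.keys_mult[of a b]
  by (fastforce simp: homog_def plus_list_def word_deg_def)

lemma homog_diff: "homog d a \<Longrightarrow> homog d b \<Longrightarrow> homog d (a - b)"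
  using Poly_Mapping.keys_diff[of a b] by (auto simp: homog_def)

lemma homog_prod_list: "list_all2 homog ns as \<Longrightarrow> homog (sum_list ns) (prod_list as)"
  by (induction rule: list_all2_induct) (simp_all add: homog_one homog_mult)

text \<open>By induction the inner L_i \<rhd> a_{i+1} is d_i times the product of the first
  \<open>i + 1\<close> entries, homogeneous of degree n_1 + ... + n_{i+1}. It is followed by
  \<open>l - i - 1\<close> further factors, so pairing with \<open>b\<close> gives a binomial with
  lower index \<open>l - i\<close>, and the scalars sum up by
  \<open>dcoeff_recursion\<close>.\<close>

lemma L_op_rhd:
  assumes "list_all2 homog ns as"
  shows "L_op as \<rhd> iota b = scal (of_nat (dcoeff ns)) * (prod_list as * b)"
  using assms
proof (induction "length as" arbitrary: ns as b rule: less_induct)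
  case less
  let ?l = "length ns"
  have len: "length as = ?l" using less.prems by (simp add: list_all2_lengthD)
  show ?case
  proof (cases "as = []")
    case True
    then show ?thesis using less.prems by (simp add: L_op.simps rhd_one dcoeff_Nil)
  next
    case False
    then have ns: "ns \<noteq> []" using len by auto
    let ?D = "\<lambda>i. of_nat (dcoeff (take i ns)) :: 'a"
    let ?C = "\<lambda>i. of_nat ((sum_list (take (Suc i) ns) + 1) choose (?l - i)) :: 'a"
    have "(iota (L_op (take i as) \<rhd> iota (as ! i)) * tens (drop (i+1) as)) \<rhd> iota b =
        scal (?D i * ?C i) * (prod_list as * b)" if i: "i < ?l" for i
    proof -
      let ?p = "prod_list (take (Suc i) as)"
      have "L_op (take i as) \<rhd> iota (as ! i) = scal (?D i) * (prod_list (take i as) * (as ! i))"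
        using less i len by (intro less.hyps) auto
      also have "prod_list (take i as) * (as ! i) = ?p"
        using i len by (simp add: take_Suc_conv_app_nth)
      finally have L: "L_op (take i as) \<rhd> iota (as ! i) = scal (?D i) * ?p" .
      have "homog (sum_list (take (Suc i) ns)) ?p"
        using less.prems by (intro homog_prod_list list_all2_takeI)
      then have "tens (?p # drop (Suc i) as) \<rhd> tens [b] = scal (?C i) * (?p * prod_list (drop (Suc i) as) * b)"
        using i len
        by (subst rhd_homog) (simp_all add: scal_of_nat mult.assoc Suc_diff_Suc del: binomial_Suc_Suc)
      also have "?p * prod_list (drop (Suc i) as) = prod_list as"
        by (simp flip: prod_list.append)
      finally show ?thesis
        by (simp add: L iota_scal rhd_bilinear mult.assoc scal_scal flip: tens_Cons iota_eq_tens)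
    qed
    then have "L_op as \<rhd> iota b = (\<Sum>i<?l. scal ((-1) ^ (?l - 1 - i) * (?D i * ?C i)) * (prod_list as * b))"
      using False len
      by (subst L_op.simps) (simp add: rhd_sum_left scal_minus_one_power rhd_bilinear scal_scal)
    also have "\<dots> = scal (of_nat (dcoeff ns)) * (prod_list as * b)"
      unfolding sum_distrib_right[symmetric] scal_sum dcoeff_recursion[OF ns] ..
    finally show ?thesis .
  qed
qed


section \<open>Cutting lists along a composition, and the operators R and R^e\<close>

lemma psum_add_le:
  assumes "p \<in> comps n j" "i < j"
  shows "psum p i + p ! i \<le> n" "0 < p ! i"
proof -
  have "n = psum p i + sum_list (drop i p)"
    using assms by (simp add: comps_def psum_def flip: sum_list_append)
  also have "drop i p = p ! i # drop (Suc i) p"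
    using assms by (simp add: comps_def Cons_nth_drop_Suc)
  finally show "psum p i + p ! i \<le> n" by simp
  show "0 < p ! i" using assms by (auto simp: comps_def)
qed

lemma Cons_block:
  assumes "p \<in> comps (length as) j" "i < j"
  shows "as ! psum p i # block p i as = take (p ! i) (drop (psum p i) as)"
proof -
  from psum_add_le[OF assms] have *: "psum p i < length as" "p ! i = Suc (p ! i - 1)"
    by auto
  show ?thesis
    by (subst *(2), subst Cons_nth_drop_Suc[OF *(1), symmetric]) (simp add: block_def)
qed

lemma prod_list_blocks:
  "prod_list (map (\<lambda>i. prod_list (take (p ! i) (drop (psum p i) as))) [0..<length p]) =
    prod_list (take (sum_list p) (as :: 'a::monoid_mult list))"
proof (induction p arbitrary: as)
  case (Cons x p)
  then show ?case
    using Cons[of "drop x as"]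
    by (simp add: upt_conv_Cons take_add map_Suc_upt[symmetric] comp_def add.commute del: upt_Suc)
qed simp

lemma zip_take_take: "k \<le> m \<Longrightarrow> zip (take k xs) (take m ys) = zip (take k xs) (take k ys)"
  by (rule nth_equalityI) auto

text \<open>Each summand of the recursion contains R_1^(2) = 0 as a left operand.\<close>

lemma Re_op_Cons_2: "Re_op (2 # es) (a # as) = 0"
proof -
  have 1: "Re_op [2] [a] = 0" by (simp add: Re_op.simps)
  show ?thesis
    by (subst Re_op.simps) (simp add: 1)
qed

text \<open>Since R_1^(1) is the identity, the first tensor factor has the same form as the others.
  The sum also covers length 1, where the only block is a single letter and the factor is a \<rhd> 1
  = a.\<close>

lemma Re_op_Cons_1:
  fixes as :: "'f::field HH list"
  assumes "es \<noteq> []" "es ! 0 = 1" "as \<noteq> []"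
  shows "Re_op es as = (\<Sum>j=1..length as. \<Sum>p\<in>comps (length as) j.
    prod_list (map (\<lambda>i. iota (iota (as ! psum p i) \<rhd> Re_op (block p i es) (block p i as))) [0..<j]))"
proof (cases "length as = 1")
  case True
  then have "block [Suc 0] 0 as = []" by (simp add: block_def)
  moreover have "Re_op es [] = (1 :: 'f TA)" for es by (simp add: Re_op.simps)
  ultimately show ?thesis
    using True assms by (subst Re_op.simps) (simp add: comps_1 iota_rhd_one)
next
  case False
  have 1: "Re_op [Suc 0] [as ! 0] = iota (as ! 0)"
    by (simp add: Re_op.simps)
  show ?thesis
    using False assms unfolding Re_op.simps[of es as]
    by (auto intro!: sum.cong simp: 1 upt_conv_Cons)
qed

text \<open>Lets one computation, that for \<open>Re_op\<close>, serve both operators.\<close>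

lemma R_op_eq_Re_op: "R_op as = Re_op (replicate (length as) 1) as"
proof (induction "length as" arbitrary: as rule: less_induct)
  case less
  show ?case
  proof (cases "as = []")
    case True
    then show ?thesis by (simp add: R_op.simps Re_op.simps)
  next
    case False
    have "R_op (block p i as) = Re_op (block p i (replicate (length as) 1)) (block p i as)" for p i
    proof -
      have "block p i (replicate (length as) (1::nat)) = replicate (length (block p i as)) 1"
        by (simp add: block_def)
      then show ?thesis using less[OF length_block_less[OF False]] by simp
    qed
    with False show ?thesis
      by (subst R_op.simps, subst Re_op_Cons_1) auto
  qed
qed

text \<open>The entries of \<open>es\<close> belong to the letters of \<open>a # as\<close> in
  order, so \<open>map2\<close> leaves out the last letter, which plays the fictitious closing
  down-step. A tensor of \<open>j\<close> factors paired with \<open>a\<close> yields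
  \<open>(n + 1) choose j\<close>, each factor yields the path sum of its block by induction, and
  the total is the block decomposition of a path that starts with \<open>m = j\<close>.\<close>

lemma Re_op_rhd:
  assumes "list_all2 homog ns (a # as)" "length es = length as" "set es \<subseteq> {1, 2}"
  shows "iota a \<rhd> Re_op es as = scal (of_nat (path_sum 0 (map2 wt es ns))) * (a * prod_list as)"
  using assms
proof (induction "length as" arbitrary: ns a as es rule: less_induct)
  case less
  from less.prems(1) obtain n ns' where ns: "ns = n # ns'" "homog n a" "list_all2 homog ns' as"
    by (cases ns) auto
  then have len: "length ns' = length as" by (simp add: list_all2_lengthD)
  show ?case
  proof (cases es)
    case Nil
    then show ?thesis using less.prems by (simp add: Re_op.simps iota_rhd_one)
  next
    case (Cons e es')
    then obtain a' as' where as: "as = a' # as'" using less.prems by (cases as) auto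
    show ?thesis
    proof (cases "e = 2")
      case True
      \<comment> \<open>A path from height 0 must start with \<open>m\<close> at least 1, where
        \<open>wt 2\<close> vanishes.\<close>
      have "path_sum 0 (map2 wt es ns) = 0"
        by (simp add: Cons True ns wt_def)
      then show ?thesis by (simp add: Cons True as Re_op_Cons_2)
    next
      case False
      then have e: "e = 1" using less.prems Cons by auto
      \<comment> \<open>\<open>W\<close> weighs all letters of \<open>as\<close> but the last, so
        the compositions of \<open>length as\<close> are those of \<open>Suc (length W)\<close>, as
        in \<open>path_sum_0_Cons_blocks\<close>.\<close>
      define W where "W = map2 wt es' ns'"
      have W: "Suc (length W) = length as" "\<forall>w\<in>set W. w 0 = 1"
        using less.prems(2) len by (auto simp: W_def Cons)
      let ?c = "\<lambda>p i. path_sum 0 (take (p ! i - 1) (drop (psum p i) W))"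
      \<comment> \<open>This is the induction hypothesis with the head of a block as left operand.
        The last letter of the block gets no weight: it is the closing down-step.\<close>
      have factor: "iota (as ! psum p i) \<rhd> Re_op (block p i es) (block p i as) =
          scal (of_nat (?c p i)) * prod_list (take (p ! i) (drop (psum p i) as))"
        if p: "p \<in> comps (length as) j" and i: "i < j" for p i j
      proof -
        let ?ns = "take (p ! i) (drop (psum p i) ns')"
        have "list_all2 homog ?ns (as ! psum p i # block p i as)"
          unfolding Cons_block[OF p i] using ns(3) by (intro list_all2_takeI list_all2_dropI)
        moreover have "length (block p i as) < length as"
          by (rule length_block_less) (simp add: as)
        moreover have "length (block p i es) = length (block p i as)"
          using less.prems by (simp add: block_def)
        moreover have "set (block p i es) \<subseteq> {1, 2}"
          using less.prems(3) by (auto simp: block_def dest!: in_set_takeD in_set_dropD)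
        ultimately have "iota (as ! psum p i) \<rhd> Re_op (block p i es) (block p i as) =
            scal (of_nat (path_sum 0 (map2 wt (block p i es) ?ns))) * (as ! psum p i * prod_list (block p i as))"
          by (intro less.hyps)
        also have "as ! psum p i * prod_list (block p i as) = prod_list (take (p ! i) (drop (psum p i) as))"
          unfolding Cons_block[OF p i, symmetric] by simp
        also have "map2 wt (block p i es) ?ns = take (p ! i - 1) (drop (psum p i) W)"
        proof -
          have "zip (block p i es) ?ns = take (p ! i - 1) (drop (psum p i) (zip es' ns'))"
            unfolding take_zip drop_zip using zip_take_take[of "p ! i - 1" "p ! i"]
            by (simp add: block_def Cons)
          then show ?thesis by (simp add: W_def take_map drop_map)
        qed
        finally show ?thesis .
      qed
      have blocks: "iota a \<rhd> prod_list (map (\<lambda>i. iota (iota (as ! psum p i) \<rhd> Re_op (block p i es) (block p i as))) [0..<j]) =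
          scal (of_nat (wt e n j * (\<Prod>i<j. ?c p i))) * (a * prod_list as)"
        if p: "p \<in> comps (length as) j" for p j
      proof -
        let ?q = "\<lambda>i. prod_list (take (p ! i) (drop (psum p i) as))"
        \<comment> \<open>The scalars of the factors are pulled out of the tensor product one by
          one.\<close>
        have "prod_list (map (\<lambda>i. iota (iota (as ! psum p i) \<rhd> Re_op (block p i es) (block p i as))) [0..<k]) =
            scal (of_nat (\<Prod>i<k. ?c p i)) * tens (map ?q [0..<k])" if "k \<le> j" for k
          using that
        proof (induction k)
          case (Suc k)
          let ?P = "prod_list (map (\<lambda>i. iota (iota (as ! psum p i) \<rhd> Re_op (block p i es) (block p i as))) [0..<k])"
          let ?T = "tens (map ?q [0..<k])"
          have "?P * (scal (of_nat (?c p k)) * iota (?q k)) =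
              scal (of_nat (?c p k)) * (scal (of_nat (\<Prod>i<k. ?c p i)) * ?T * iota (?q k))"
            using Suc by (subst scal_left_commute) simp
          also have "\<dots> = scal (of_nat (\<Prod>i<Suc k. ?c p i)) * (?T * iota (?q k))"
            by (simp only: mult.assoc scal_scal) (simp add: mult.commute)
          finally show ?case
            using Suc.prems by (simp add: factor[OF p] iota_scal tens_def)
        qed simp
        then have "iota a \<rhd> prod_list (map (\<lambda>i. iota (iota (as ! psum p i) \<rhd> Re_op (block p i es) (block p i as))) [0..<j]) =
            scal (of_nat (\<Prod>i<j. ?c p i)) * (iota a \<rhd> tens (map ?q [0..<j]))"
          by (simp add: rhd_bilinear)
        also have "iota a \<rhd> tens (map ?q [0..<j]) = scal (of_nat (wt e n j)) * (a * prod_list as)"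
          unfolding iota_rhd_tens[OF ns(2)]
          using p prod_list_blocks[of p as] by (simp add: comps_def wt_def e)
        finally show ?thesis by (simp add: scal_scal mult.commute)
      qed
      have ne: "es \<noteq> []" "es ! 0 = 1" "as \<noteq> []" using Cons e as by simp_all
      have "iota a \<rhd> Re_op es as =
          scal (of_nat (\<Sum>j=1..length as. \<Sum>p\<in>comps (length as) j. wt e n j * (\<Prod>i<j. ?c p i))) * (a * prod_list as)"
        unfolding Re_op_Cons_1[OF ne] rhd_sum_right of_nat_sum scal_sum[symmetric] sum_distrib_right
        by (intro sum.cong refl) (simp only: blocks)
      also have "(\<Sum>j=1..length as. \<Sum>p\<in>comps (length as) j. wt e n j * (\<Prod>i<j. ?c p i)) = path_sum 0 (wt e n # W)"
        unfolding path_sum_0_Cons_blocks[OF W(2)] W(1) sum_distrib_left ..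
      also have "wt e n # W = map2 wt es ns"
        by (simp add: Cons ns W_def)
      finally show ?thesis .
    qed
  qed
qed

section \<open>The co-operations on generators\<close>

lemma homog_gen:
  assumes "0 < k"
  shows "homog k (xg k)" "homog k (yg k)"
  using assms by (simp_all add: homog_def xg_def yg_def wmon_def word_deg_def Abs_pnat_inverse)

lemma homog_xyg: "0 < k \<Longrightarrow> homog k (xyg e k)"
  by (simp add: xyg_def homog_gen)

lemma homog_ug_vg:
  assumes "0 < k"
  shows "homog k (ug k)" "homog k (vg k)"
  unfolding ug_def vg_def using assms by (intro homog_diff homog_gen; simp)+

lemma list_all2_homog_map:
  "(\<And>k. k \<in> set ns \<Longrightarrow> homog k (f k)) \<Longrightarrow> list_all2 homog ns (map f ns)"
  by (simp add: list_all2_conv_all_nth)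

lemma list_all2_homog_map2_xyg:
  "\<forall>k\<in>set ns. 0 < k \<Longrightarrow> length es = length ns \<Longrightarrow> list_all2 homog ns (map2 xyg es ns)"
  by (simp add: list_all2_conv_all_nth homog_xyg)

lemma comps_split:
  assumes "ns \<in> comps n (l + 1)" "l \<ge> 1"
  obtains a ms b where "ns = a # ms @ [b]" "length ms = l - 1" "0 < a" "0 < b" "\<forall>k\<in>set ms. 0 < k"
proof -
  from assms obtain a ms' where a: "ns = a # ms'" "length ms' = l"
    by (cases ns) (auto simp: comps_def)
  with assms obtain ms b where "ms' = ms @ [b]"
    by (cases ms' rule: rev_cases) auto
  with a assms show ?thesis by (intro that) (auto simp: comps_def)
qed

lemma zip_append_drop: "length xs = length ys \<Longrightarrow> zip xs (ys @ zs) = zip xs ys"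
  by (simp add: zip_append2)

lemma Delta_term:
  assumes "ns \<in> comps n (l + 1)"
  shows "iota (xg (ns ! 0)) \<rhd> tens (map yg (tl ns)) =
    of_nat ((ns ! 0 + 1) choose l) * xg (ns ! 0) * prod_list (map yg (tl ns))"
proof -
  have "0 < ns ! 0" "length ns = l + 1" using assms by (auto simp: comps_def)
  then show ?thesis
    by (simp add: iota_rhd_tens[OF homog_gen(1)] scal_of_nat mult.assoc del: binomial_Suc_Suc)
qed

lemma delta_r_term_L:
  assumes "ns \<in> comps n (l + 1)" "l \<ge> 1"
  shows "L_op (ug (ns ! 0) # map yg (take (l - 1) (tl ns))) \<rhd> iota (yg (ns ! l)) =
    of_nat (dcoeff (take l ns)) * (xg (ns ! 0) - yg (ns ! 0)) * prod_list (map yg (tl ns))"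
proof -
  from comps_split[OF assms] obtain a ms b where ns: "ns = a # ms @ [b]" "length ms = l - 1"
    "0 < a" "0 < b" "\<forall>k\<in>set ms. 0 < k" .
  from ns(2) assms(2) have l: "l = Suc (length ms)" by simp
  have "list_all2 homog (a # ms) (ug a # map yg ms)"
    using ns by (simp add: homog_ug_vg list_all2_homog_map homog_gen)
  from L_op_rhd[OF this, of "yg b"] show ?thesis
    by (simp add: ns(1) l nth_append scal_of_nat ug_def mult.assoc)
qed

lemma delta_r_term_R:
  assumes "ns \<in> comps n (l + 1)" "l \<ge> 1"
  shows "iota (ug (ns ! 0)) \<rhd> R_op (map yg (tl ns)) =
    of_nat (dcoeff (take l ns)) * (xg (ns ! 0) - yg (ns ! 0)) * prod_list (map yg (tl ns))"
proof -
  from comps_split[OF assms] obtain a ms b where ns: "ns = a # ms @ [b]" "length ms = l - 1"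
    "0 < a" "0 < b" "\<forall>k\<in>set ms. 0 < k" .
  from ns(2) assms(2) have l: "l = Suc (length ms)" by simp
  have "list_all2 homog ns (ug a # map yg (ms @ [b]))"
    using ns by (auto simp: ns(1) homog_ug_vg homog_gen simp del: map_append intro!: list_all2_homog_map)
  \<comment> \<open>The zip stops after \<open>l\<close> of the \<open>l + 1\<close> entries of
    \<open>ns\<close>, which are the arguments of d_l.\<close>
  moreover have "path_sum 0 (map2 wt (replicate l 1) ns) = dcoeff (take l ns)"
    unfolding dcoeff_eq_decoeff
    by (subst decoeff_eq_path_sum) (simp_all add: ns(1) l zip_append_drop del: path_sum.simps)
  moreover have "set (replicate l (1::nat)) \<subseteq> {1, 2}" by auto
  ultimately have "iota (ug a) \<rhd> Re_op (replicate l 1) (map yg (ms @ [b])) =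
      scal (of_nat (dcoeff (take l ns))) * (ug a * prod_list (map yg (ms @ [b])))"
    using Re_op_rhd[of ns "ug a" "map yg (ms @ [b])" "replicate l 1"] l by (simp del: path_sum.simps)
  then show ?thesis
    using l
    by (simp add: R_op_eq_Re_op ns(1) scal_of_nat ug_def mult.assoc)
qed

lemma delta_l_term:
  assumes "ns \<in> comps n (l + 1)" "l \<ge> 1" "es \<in> Eset l"
  shows "iota (xyg (es ! 0) (ns ! 0)) \<rhd> Re_op es (map2 xyg (tl es) (take (l - 1) (tl ns)) @ [vg (ns ! l)]) =
    of_nat (decoeff es (take l ns)) * prod_list (map2 xyg es (take l ns)) * (yg (ns ! l) - xg (ns ! l))"
proof -
  from comps_split[OF assms(1,2)] obtain a ms b where ns: "ns = a # ms @ [b]" "length ms = l - 1"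
    "0 < a" "0 < b" "\<forall>k\<in>set ms. 0 < k" .
  from ns(2) assms(2) have l: "l = Suc (length ms)" by simp
  with assms(3) obtain e es' where es: "es = e # es'" "length es' = length ms" "set es \<subseteq> {1, 2}"
    by (cases es) (auto simp: Eset_def)
  have "list_all2 homog ns (xyg e a # (map2 xyg es' ms @ [vg b]))"
    using ns es by (auto simp: ns(1) homog_ug_vg homog_xyg intro!: list_all2_appendI list_all2_homog_map2_xyg)
  moreover have "path_sum 0 (map2 wt es ns) = decoeff es (take l ns)"
    by (subst decoeff_eq_path_sum) (simp_all add: ns(1) l es zip_append_drop del: path_sum.simps)
  ultimately have "iota (xyg e a) \<rhd> Re_op es (map2 xyg es' ms @ [vg b]) =
      scal (of_nat (decoeff es (take l ns))) * (xyg e a * prod_list (map2 xyg es' ms @ [vg b]))"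
    using Re_op_rhd[of ns "xyg e a" "map2 xyg es' ms @ [vg b]" es] es(1-3) by (simp del: path_sum.simps)
  then show ?thesis
    by (simp add: ns(1) l es(1) nth_append scal_of_nat vg_def mult.assoc)
qed

text \<open>The summand \<open>l = 0\<close> is u_n, since d_0 = 1 and \<open>[n]\<close> is the
  only composition of length 1.\<close>

lemma delta_r_gen_split:
  assumes "n \<ge> 1"
  shows "delta_r_gen n = ug n + (\<Sum>l=1..n-1. (-1) ^ l * (\<Sum>ns\<in>comps n (l+1).
    of_nat (dcoeff (take l ns)) * (xg (ns ! 0) - yg (ns ! 0)) * prod_list (map yg (tl ns))))"
  using assms unfolding delta_r_gen_def
  by (subst sum.atLeast_Suc_atMost) (simp_all add: comps_1 dcoeff_Nil ug_def)

theorem theorem5p3p14: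
  fixes n :: nat
  assumes "n \<ge> 1"
  shows
    "(Delta (hgen n) :: 'f::field HH) =
       xg n + yg n + (\<Sum>l=1..n-1. \<Sum>ns\<in>comps n (l+1). iota (xg (ns ! 0)) \<rhd> tens (map yg (tl ns)))
     \<and>
     (delta_r (hgen n) :: 'f HH) =
       ug n + (\<Sum>l=1..n-1. (-1) ^ l * (\<Sum>ns\<in>comps n (l+1).
         L_op (ug (ns ! 0) # map yg (take (l-1) (tl ns))) \<rhd> iota (yg (ns ! l))))
     \<and>
     (delta_r (hgen n) :: 'f HH) =
       ug n + (\<Sum>l=1..n-1. (-1) ^ l * (\<Sum>ns\<in>comps n (l+1).
         iota (ug (ns ! 0)) \<rhd> R_op (map yg (tl ns))))
     \<and>
     (delta_l (hgen n) :: 'f HH) =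
       vg n + (\<Sum>l=1..n-1. (-1) ^ l * (\<Sum>ns\<in>comps n (l+1). \<Sum>es\<in>Eset l. esign es *
         (iota (xyg (es ! 0) (ns ! 0)) \<rhd>
          Re_op es (map2 xyg (tl es) (take (l-1) (tl ns)) @ [vg (ns ! l)]))))"
  unfolding cooperations_hgen[OF assms]
proof (intro conjI)
  show "(Delta_gen n :: 'f HH) =
       xg n + yg n + (\<Sum>l=1..n-1. \<Sum>ns\<in>comps n (l+1). iota (xg (ns ! 0)) \<rhd> tens (map yg (tl ns)))"
    unfolding Delta_gen_def by (intro arg_cong2[where f = "(+)"] refl sum.cong) (simp only: Delta_term)
  show "(delta_r_gen n :: 'f HH) =
       ug n + (\<Sum>l=1..n-1. (-1) ^ l * (\<Sum>ns\<in>comps n (l+1).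
         L_op (ug (ns ! 0) # map yg (take (l-1) (tl ns))) \<rhd> iota (yg (ns ! l))))"
    unfolding delta_r_gen_split[OF assms]
    by (intro arg_cong2[where f = "(+)"] arg_cong2[where f = "(*)"] refl sum.cong)
      (simp only: delta_r_term_L atLeastAtMost_iff)
  show "(delta_r_gen n :: 'f HH) =
       ug n + (\<Sum>l=1..n-1. (-1) ^ l * (\<Sum>ns\<in>comps n (l+1).
         iota (ug (ns ! 0)) \<rhd> R_op (map yg (tl ns))))"
    unfolding delta_r_gen_split[OF assms]
    by (intro arg_cong2[where f = "(+)"] arg_cong2[where f = "(*)"] refl sum.cong)
      (simp only: delta_r_term_R atLeastAtMost_iff)
  show "(delta_l_gen n :: 'f HH) =
       vg n + (\<Sum>l=1..n-1. (-1) ^ l * (\<Sum>ns\<in>comps n (l+1). \<Sum>es\<in>Eset l. esign es *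
         (iota (xyg (es ! 0) (ns ! 0)) \<rhd>
          Re_op es (map2 xyg (tl es) (take (l-1) (tl ns)) @ [vg (ns ! l)]))))"
    \<comment> \<open>Reassociating sets the sign apart, so that only the factors after it remain to
      be compared.\<close>
    unfolding delta_l_gen_def vg_def[of n] mult.assoc[of "esign _"]
    by (intro arg_cong2[where f = "(+)"] arg_cong2[where f = "(*)"] refl sum.cong)
      (simp only: delta_l_term atLeastAtMost_iff)
qed

end
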